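(* Let $n$ be a positive integer and let $i,j$ be positive integers with $1 \leq j < i \leq n$. Then, as polynomials in $\mathbb{Z}[x_1,\ldots,x_n]$, $$ f_{i-1,j}=\sum_{k=1}^{i-j} (-1)^{k-1}\, \mathfrak{S}_{w_k^{(i,j)}}, $$ where $f_{i-1,j}=\sum_{k=1}^{j}\big(\prod_{\ell=j+1}^{i-1}(x_k-x_\ell)\big)x_k$, where $\mathfrak{S}_w$ denotes the Schubert polynomial of a permutation $w \in S_n$, and where, for $1 \leq k \leq i-j$, $$ w_k^{(i,j)}:=(s_{i-k}s_{i-k-1}\cdots s_{j})(s_{i-k+1}s_{i-k+2}\cdots s_{i-1}) \in S_n . $$
   Context: Polynomials $f_{i,j}$: for $1 \leq j \leq i$, $f_{i,j}:=\sum_{k=1}^{j}\big(\prod_{\ell=j+1}^{i}(x_k-x_\ell)\big)x_k$, where the product is $1$ by convention when $j=i$. Permutations: $S_n$ is the symmetric group on $\{1,\ldots,n\}$, products are compositions of functions (the rightmost factor is applied first), and $s_r$ is the transposition of $r$ and $r+1$ for $r=1,\ldots,n-1$. In the definition of $w_k^{(i,j)}$, the first parenthesized factor has decreasing indices from $i-k$ down to $j$, the second has increasing indices from $i-k+1$ up to $i-1$, and the second is the identity by convention when $k=1$. Length: $\ell(w)=\#\{a<b \mid w(a)>w(b)\}$. Divided difference operators: for $1\le r\le n-1$ and $f\in\mathbb{Z}[x_1,\ldots,x_n]$, $\partial_r(f):=\dfrac{f-s_r(f)}{x_r-x_{r+1}}$, where $s_r(f)$ is obtained from $f$ by interchanging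 $x_r$ and $x_{r+1}$; this is always a polynomial. Schubert polynomials: let $w_0=[n,n-1,\ldots,1]\in S_n$ (one-line notation) be the longest permutation, and set $\mathfrak{S}_{w_0}=x_1^{n-1}x_2^{n-2}\cdots x_{n-1}$. For general $w\in S_n$, write $w=w_0s_{i_1}s_{i_2}\cdots s_{i_r}$ with $\ell(w_0s_{i_1}\cdots s_{i_p})=\ell(w_0)-p$ for $1\leq p\leq r$; then $\mathfrak{S}_w:=\partial_{i_r}\circ\cdots\circ\partial_{i_2}\circ\partial_{i_1}(\mathfrak{S}_{w_0})$, which is independent of the choice of such an expression. *)

theory Defs
  imports "HOL-Library.Poly_Mapping" "HOL-Combinatorics.Permutations"
begin

text \<open>
  Finitely supported functions from exponent vectors to coefficients, with convolution product:
  integer polynomials in the variables \<open>x\<^sub>0, x\<^sub>1, x\<^sub>2, \<dots>\<close>. The ring \<open>\<int>[x\<^sub>1, \<dots>, x\<^sub>n]\<close> is the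
  subring of the polynomials that involve only the variables with index in \<open>{1..n}\<close>.
\<close>

type_synonym mpoly = "(nat \<Rightarrow>\<^sub>0 nat) \<Rightarrow>\<^sub>0 int"

definition Xvar :: "nat \<Rightarrow> mpoly" where
  "Xvar k = Poly_Mapping.single (Poly_Mapping.single k 1) 1"

definition f_poly :: "nat \<Rightarrow> nat \<Rightarrow> mpoly" where
  "f_poly i j = (\<Sum>k=1..j. (\<Prod>l=j+1..i. Xvar k - Xvar l) * Xvar k)"


text \<open>
  Permutations of \<open>{1..n}\<close> are functions on \<^typ>\<open>nat\<close> that are the identity outside \<open>{1..n}\<close>,
  as for \<^const>\<open>permutes\<close>.
\<close>

definition s_adj :: "nat \<Rightarrow> nat \<Rightarrow> nat" where
  "s_adj r = Transposition.transpose r (r + 1)"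

definition s_word :: "nat list \<Rightarrow> nat \<Rightarrow> nat" where
  "s_word rs = foldr (\<circ>) (map s_adj rs) id"

definition longest_perm :: "nat \<Rightarrow> nat \<Rightarrow> nat" where
  "longest_perm n a = (if a \<in> {1..n} then n + 1 - a else a)"

definition perm_length :: "nat \<Rightarrow> (nat \<Rightarrow> nat) \<Rightarrow> nat" where
  "perm_length n w = card {(a, b). a \<in> {1..n} \<and> b \<in> {1..n} \<and> a < b \<and> w a > w b}"


text \<open>
  The inner \<^const>\<open>Poly_Mapping.map_key\<close> precomposes an exponent vector with the transposition of
  \<open>r\<close> and \<open>r + 1\<close>; the outer one relabels the monomials of \<open>f\<close> accordingly.
\<close>

definition swap_vars :: "nat \<Rightarrow> mpoly \<Rightarrow> mpoly" where
  "swap_vars r f = Poly_Mapping.map_key (Poly_Mapping.map_key (s_adj r)) f"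

definition div_diff :: "nat \<Rightarrow> mpoly \<Rightarrow> mpoly" where
  "div_diff r f = (THE g. (Xvar r - Xvar (r + 1)) * g = f - swap_vars r f)"


text \<open>
  \<open>descending_word n w rs\<close>: the list \<open>rs = [i\<^sub>1, \<dots>, i\<^sub>r]\<close> satisfies \<open>w = w\<^sub>0 s\<^bsub>i\<^sub>1\<^esub> \<cdots> s\<^bsub>i\<^sub>r\<^esub>\<close>, and every
  factor lowers the length by one.
\<close>

definition descending_word :: "nat \<Rightarrow> (nat \<Rightarrow> nat) \<Rightarrow> nat list \<Rightarrow> bool" where
  "descending_word n w rs \<longleftrightarrow>
     set rs \<subseteq> {1..<n} \<and>
     w = longest_perm n \<circ> s_word rs \<and>
     (\<forall>p\<in>{1..length rs}.
        perm_length n (longest_perm n \<circ> s_word (take p rs)) + p = perm_length n (longest_perm n))"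

text \<open>
  The definite description expresses that the polynomial does not depend on the word:
  \<^term>\<open>fold div_diff [i\<^sub>1, i\<^sub>2] g\<close> is \<^term>\<open>div_diff i\<^sub>2 (div_diff i\<^sub>1 g)\<close>.
\<close>

definition schubert :: "nat \<Rightarrow> (nat \<Rightarrow> nat) \<Rightarrow> mpoly" where
  "schubert n w =
     (THE P. \<exists>rs. descending_word n w rs \<and> P = fold div_diff rs (\<Prod>k=1..n-1. Xvar k ^ (n - k)))"


definition w_perm :: "nat \<Rightarrow> nat \<Rightarrow> nat \<Rightarrow> nat \<Rightarrow> nat" where
  "w_perm i j k = s_word (rev [j..<i - k + 1]) \<circ> s_word [i - k + 1..<i]"

end

theory Submission
  imports Defs
begin

text \<open>
  A polynomial in \<open>x\<^sub>1, \<dots>, x\<^bsub>n-1\<^esub>\<close> without constant term is determined by its images under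
  \<open>\<partial>\<^sub>1, \<dots>, \<partial>\<^bsub>n-1\<^esub>\<close>: a polynomial killed by all of them is symmetric in \<open>x\<^sub>1, \<dots>, x\<^sub>n\<close>, and without
  \<open>x\<^sub>n\<close> it is constant. Both sides of the identity satisfy the same recursion: \<open>\<partial>\<^bsub>i-1\<^esub>\<close> sends the
  side for \<open>(i, j)\<close> to minus the side for \<open>(i - 1, j)\<close>, \<open>\<partial>\<^sub>j\<close> sends it to the side for \<open>(i, j + 1)\<close>,
  the other operators kill it, and for \<open>j = i - 1\<close> its image under \<open>\<partial>\<^sub>j\<close> is \<open>1\<close>. That Schubert
  polynomials do not depend on the word follows from the braid relations, by induction on the
  colength.
\<close>

subsection \<open>Divided differences\<close>

abbreviation (input) "lookup \<equiv> Poly_Mapping.lookup"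
abbreviation (input) "keys \<equiv> Poly_Mapping.keys"

section \<open>The action of adjacent transpositions on exponents and polynomials\<close>

lemma inj_s_adj: "inj (s_adj r)"
  by (simp add: s_adj_def)

lemma s_adj_involutory [simp]: "s_adj r (s_adj r a) = a"
  by (simp add: s_adj_def)

lemma s_adj_comp_s_adj [simp]: "s_adj r \<circ> s_adj r = id"
  by (simp add: fun_eq_iff)

lemma s_adj_apply: "s_adj r a = (if a = r then r + 1 else if a = r + 1 then r else a)"
  by (simp add: s_adj_def transpose_def)

abbreviation swap_exps :: "nat \<Rightarrow> (nat \<Rightarrow>\<^sub>0 nat) \<Rightarrow> (nat \<Rightarrow>\<^sub>0 nat)" where
  "swap_exps r \<equiv> Poly_Mapping.map_key (s_adj r)"

lemma lookup_swap_exps [simp]: "lookup (swap_exps r m) k = lookup m (s_adj r k)"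
  by (simp add: map_key.rep_eq inj_s_adj)

lemma swap_exps_involutory [simp]: "swap_exps r (swap_exps r m) = m"
  by (rule poly_mapping_eqI) simp

lemma inj_swap_exps: "inj (swap_exps r)"
  by (metis injI swap_exps_involutory)

lemma swap_exps_add: "swap_exps r (a + b) = swap_exps r a + swap_exps r b"
  by (rule poly_mapping_eqI) (simp add: lookup_add)

lemma swap_exps_single [simp]: "swap_exps r (Poly_Mapping.single k v) = Poly_Mapping.single (s_adj r k) v"
  by (metis inj_s_adj map_key_single s_adj_involutory)

lemma lookup_swap_vars: "lookup (swap_vars r f) m = lookup f (swap_exps r m)"
  by (simp add: swap_vars_def map_key.rep_eq inj_swap_exps)

lemma swap_vars_involutory [simp]: "swap_vars r (swap_vars r f) = f"
  by (rule poly_mapping_eqI) (simp add: lookup_swap_vars)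

lemma swap_vars_0 [simp]: "swap_vars r 0 = 0"
  by (rule poly_mapping_eqI) (simp add: lookup_swap_vars)

lemma swap_vars_add: "swap_vars r (f + g) = swap_vars r f + swap_vars r g"
  by (rule poly_mapping_eqI) (simp add: lookup_swap_vars lookup_add)

lemma swap_vars_minus: "swap_vars r (- f) = - swap_vars r f"
  by (rule poly_mapping_eqI) (simp add: lookup_swap_vars)

lemma swap_vars_diff: "swap_vars r (f - g) = swap_vars r f - swap_vars r g"
  by (rule poly_mapping_eqI) (simp add: lookup_swap_vars lookup_minus)

lemma swap_vars_single [simp]:
  "swap_vars r (Poly_Mapping.single m c) = Poly_Mapping.single (swap_exps r m) c"
  by (metis inj_swap_exps map_key_single swap_exps_involutory swap_vars_def)

text \<open>Updating a coefficient outside the support is the same as adding a monomial term. The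
  rule reduces multiplicativity of \<open>swap_vars\<close> to products of monomials.\<close>

lemma mpoly_add_induct [case_names single add]:
  assumes "\<And>m c. P (Poly_Mapping.single m c)"
    and "\<And>f g. P f \<Longrightarrow> P g \<Longrightarrow> P (f + g)"
  shows "P (f :: mpoly)"
proof (induction f rule: update_induct)
  case const
  show ?case using assms(1)[of 0 0] by simp
next
  case (update f a b)
  have "Poly_Mapping.update a b f = f + Poly_Mapping.single a b"
    using update(1) by (intro poly_mapping_eqI) (auto simp: lookup_update lookup_add lookup_single in_keys_iff)
  then show ?case using assms update(3) by simp
qed

lemma swap_vars_mult: "swap_vars r (f * g) = swap_vars r f * swap_vars r g"
proof (induction f rule: mpoly_add_induct)
  case (single m c)
  show ?case
    by (induction g rule: mpoly_add_induct)
      (simp_all add: mult_single swap_exps_add swap_vars_add distrib_left)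
next
  case (add f g)
  then show ?case by (simp add: swap_vars_add distrib_right)
qed

lemma swap_vars_1 [simp]: "swap_vars r 1 = 1"
proof -
  have "swap_exps r 0 = 0" by (rule poly_mapping_eqI) simp
  then show ?thesis
    by (metis single_one swap_vars_single)
qed

lemma swap_vars_Xvar [simp]: "swap_vars r (Xvar k) = Xvar (s_adj r k)"
  by (simp add: Xvar_def)

lemma swap_vars_sum: "swap_vars r (\<Sum>k\<in>A. f k) = (\<Sum>k\<in>A. swap_vars r (f k))"
  by (induction A rule: infinite_finite_induct) (simp_all add: swap_vars_add)

lemma swap_vars_prod: "swap_vars r (\<Prod>k\<in>A. f k) = (\<Prod>k\<in>A. swap_vars r (f k))"
  by (induction A rule: infinite_finite_induct) (simp_all add: swap_vars_mult)

lemma swap_vars_power: "swap_vars r (f ^ e) = swap_vars r f ^ e"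
  by (induction e) (simp_all add: swap_vars_mult)

section \<open>Existence of the quotient by \<open>x_r - x_(r+1)\<close> and control of its
  support\<close>

lemma Xvar_neq: "k \<noteq> l \<Longrightarrow> Xvar k - Xvar l \<noteq> 0"
proof
  assume "k \<noteq> l" and "Xvar k - Xvar l = 0"
  then have "Xvar k = Xvar l" by simp
  then have "lookup (Xvar k) (Poly_Mapping.single k 1) = lookup (Xvar l) (Poly_Mapping.single k 1)" by simp
  then have "Poly_Mapping.single k (1::nat) = Poly_Mapping.single l 1"
    by (auto simp: Xvar_def lookup_single when_def split: if_splits)
  with \<open>k \<noteq> l\<close> show False
    by (metis lookup_single_eq lookup_single_not_eq zero_neq_one)
qed

lemma Xvar_power: "Xvar k ^ e = Poly_Mapping.single (Poly_Mapping.single k e) 1"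
  by (induction e) (simp_all add: Xvar_def mult_single single_add[symmetric])

text \<open>An upper bound for the support of the divided difference of the monomial with exponent
  vector \<open>m\<close>. The strict drop of the maximum is what later keeps exponents below the
  staircase \<open>n - k\<close>.\<close>

definition reduced_exps :: "nat \<Rightarrow> (nat \<Rightarrow>\<^sub>0 nat) \<Rightarrow> (nat \<Rightarrow>\<^sub>0 nat) set" where
  "reduced_exps r m = {u. (\<forall>k. k \<noteq> r \<longrightarrow> k \<noteq> r + 1 \<longrightarrow> lookup u k = lookup m k) \<and>
     lookup u r + lookup u (r + 1) + 1 = lookup m r + lookup m (r + 1) \<and>
     max (lookup u r) (lookup u (r + 1)) < max (lookup m r) (lookup m (r + 1))}"

text \<open>After a factor symmetric in \<open>x_r\<close> and \<open>x_(r+1)\<close> is split off,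
  what remains is \<open>x_r^d - x_(r+1)^d\<close>, whose quotient is the usual geometric
  sum.\<close>

lemma monomial_quotient:
  "\<exists>g. (Xvar r - Xvar (r + 1)) * g
      = Poly_Mapping.single m c - swap_vars r (Poly_Mapping.single m c)
    \<and> keys g \<subseteq> reduced_exps r m"
proof -
  have *: "\<exists>g. (Xvar r - Xvar (r + 1)) * g
        = Poly_Mapping.single m c - swap_vars r (Poly_Mapping.single m c)
      \<and> keys g \<subseteq> reduced_exps r m" if le: "lookup m (r + 1) \<le> lookup m r" for m
  proof -
    define d where "d = lookup m r - lookup m (r + 1)"
    \<comment> \<open>Lowering the exponent of \<open>x_r\<close> to that of \<open>x_(r+1)\<close>
      leaves a vector fixed by the swap.\<close>
    define b where "b = m - Poly_Mapping.single r d"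
    have lb: "lookup b k = (if k = r then lookup m (r + 1) else lookup m k)" for k
      using le by (auto simp: b_def d_def minus_poly_mapping.rep_eq lookup_single when_def)
    have m: "m = b + Poly_Mapping.single r d"
      using le by (intro poly_mapping_eqI) (auto simp: lookup_add lb lookup_single when_def d_def)
    have swap: "swap_exps r b = b"
      by (rule poly_mapping_eqI) (auto simp: lb s_adj_apply)
    let ?g = "\<Sum>e<d. Poly_Mapping.single
      (b + Poly_Mapping.single (r + 1) (d - Suc e) + Poly_Mapping.single r e) c"
    have "?g = (\<Sum>e<d. Poly_Mapping.single b c * (Xvar (r + 1) ^ (d - Suc e) * Xvar r ^ e))"
      by (intro sum.cong) (simp_all add: Xvar_power mult_single ac_simps)
    also have "(Xvar r - Xvar (r + 1)) * \<dots>
      = Poly_Mapping.single b c * ((Xvar r - Xvar (r + 1)) * (\<Sum>e<d. Xvar (r + 1) ^ (d - Suc e) * Xvar r ^ e))"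
      by (simp add: sum_distrib_left[symmetric] mult.left_commute)
    also have "\<dots> = Poly_Mapping.single b c * (Xvar r ^ d - Xvar (r + 1) ^ d)"
      by (simp only: power_diff_sumr2)
    also have "\<dots> = Poly_Mapping.single m c - swap_vars r (Poly_Mapping.single m c)"
      by (simp add: right_diff_distrib Xvar_power mult_single m swap_exps_add swap s_adj_apply)
    finally have eq: "(Xvar r - Xvar (r + 1)) * ?g = Poly_Mapping.single m c - swap_vars r (Poly_Mapping.single m c)" .
    have "keys ?g \<subseteq> reduced_exps r m"
    proof (rule order.trans[OF keys_sum] , intro UN_least)
      fix e assume "e \<in> {..<d}"
      then show "keys (Poly_Mapping.single
          (b + Poly_Mapping.single (r + 1) (d - Suc e) + Poly_Mapping.single r e) c) \<subseteq> reduced_exps r m"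
        using le by (auto simp: reduced_exps_def lookup_add lb lookup_single when_def d_def)
    qed
    with eq show ?thesis by blast
  qed
  show ?thesis
  proof (cases "lookup m (r + 1) \<le> lookup m r")
    case True
    then show ?thesis by (rule *)
  next
    case False
    \<comment> \<open>The difference changes sign when \<open>m\<close> is swapped, so the negated
      quotient for the swapped vector serves.\<close>
    then have "lookup (swap_exps r m) (r + 1) \<le> lookup (swap_exps r m) r"
      by (simp add: s_adj_apply)
    from *[OF this] obtain g where g: "(Xvar r - Xvar (r + 1)) * g
        = Poly_Mapping.single (swap_exps r m) c - Poly_Mapping.single m c"
      and k: "keys g \<subseteq> reduced_exps r (swap_exps r m)"
      by auto
    have "reduced_exps r (swap_exps r m) = reduced_exps r m"
      by (auto simp: reduced_exps_def s_adj_apply max.commute add.commute)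
    with g k show ?thesis
      by (intro exI[of _ "- g"]) (simp add: algebra_simps)
  qed
qed

text \<open>The monomial quotients add up. The support bound travels along because degree and
  variables of Schubert polynomials are read off from it.\<close>

lemma quotient_exists:
  "\<exists>g. (Xvar r - Xvar (r + 1)) * g = f - swap_vars r f \<and> keys g \<subseteq> (\<Union>m\<in>keys f. reduced_exps r m)"
proof (induction f rule: update_induct)
  case const
  show ?case by (intro exI[of _ 0]) simp
next
  case (update f a b)
  have eq: "Poly_Mapping.update a b f = f + Poly_Mapping.single a b"
    using update(1) by (intro poly_mapping_eqI) (auto simp: lookup_update lookup_add lookup_single in_keys_iff)
  have keys: "keys (Poly_Mapping.update a b f) = insert a (keys f)"
    using update(2) by (simp add: keys_update)
  obtain g where g: "(Xvar r - Xvar (r + 1)) * g = f - swap_vars r f"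
    "keys g \<subseteq> (\<Union>m\<in>keys f. reduced_exps r m)" using update(3) by blast
  obtain h where h: "(Xvar r - Xvar (r + 1)) * h
      = Poly_Mapping.single a b - swap_vars r (Poly_Mapping.single a b)"
    "keys h \<subseteq> reduced_exps r a" using monomial_quotient by blast
  have "(Xvar r - Xvar (r + 1)) * (g + h) = Poly_Mapping.update a b f - swap_vars r (Poly_Mapping.update a b f)"
    by (simp only: eq distrib_left g h swap_vars_add) simp
  moreover have "keys (g + h) \<subseteq> (\<Union>m\<in>keys (Poly_Mapping.update a b f). reduced_exps r m)"
    using keys_add[of g h] g(2) h(2) keys by blast
  ultimately show ?case by blast
qed

section \<open>Algebraic rules for divided differences\<close>

lemma div_diff_eqI:
  assumes "(Xvar r - Xvar (r + 1)) * g = f - swap_vars r f"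
  shows "div_diff r f = g"
  unfolding div_diff_def
proof (rule the_equality[of _ g])
  show "(Xvar r - Xvar (r + 1)) * g = f - swap_vars r f" by fact
  fix h assume "(Xvar r - Xvar (r + 1)) * h = f - swap_vars r f"
  with assms have "(Xvar r - Xvar (r + 1)) * h = (Xvar r - Xvar (r + 1)) * g" by simp
  \<comment> \<open>Uniqueness of the quotient: polynomials form an integral domain and the divisor
    is nonzero.\<close>
  then show "h = g" using Xvar_neq[of r "r + 1"] by (metis mult_cancel_left n_not_Suc_n Suc_eq_plus1)
qed

lemma div_diff_mult: "(Xvar r - Xvar (r + 1)) * div_diff r f = f - swap_vars r f"
  by (metis div_diff_eqI quotient_exists)

lemma keys_div_diff: "keys (div_diff r f) \<subseteq> (\<Union>m\<in>keys f. reduced_exps r m)"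
  by (metis div_diff_eqI quotient_exists)

lemma div_diff_0 [simp]: "div_diff r 0 = 0"
  by (rule div_diff_eqI) simp

lemma div_diff_add: "div_diff r (f + g) = div_diff r f + div_diff r g"
  by (rule div_diff_eqI) (simp only: distrib_left div_diff_mult swap_vars_add, simp)

lemma div_diff_minus: "div_diff r (- f) = - div_diff r f"
  by (rule div_diff_eqI) (simp only: mult_minus_right div_diff_mult swap_vars_minus, simp)

lemma div_diff_diff: "div_diff r (f - g) = div_diff r f - div_diff r g"
  using div_diff_add[of r f "- g"] by (simp add: div_diff_minus)

lemma div_diff_sum: "div_diff r (\<Sum>k\<in>A. f k) = (\<Sum>k\<in>A. div_diff r (f k))"
  by (induction A rule: infinite_finite_induct) (simp_all add: div_diff_add)

text \<open>Factors symmetric in \<open>x_r\<close> and \<open>x_(r+1)\<close> behave as scalars,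
  since they come out of both terms of the numerator.\<close>

lemma div_diff_symmetric_mult:
  assumes "swap_vars r f = f"
  shows "div_diff r (f * g) = f * div_diff r g"
  by (rule div_diff_eqI) (simp add: assms swap_vars_mult mult.left_commute div_diff_mult[simplified] right_diff_distrib)

lemma div_diff_symmetric: "swap_vars r f = f \<Longrightarrow> div_diff r f = 0"
  by (rule div_diff_eqI) simp

text \<open>Numerator and denominator both change sign under the swap.\<close>

lemma swap_vars_div_diff: "swap_vars r (div_diff r f) = div_diff r f"
proof -
  have "swap_vars r ((Xvar r - Xvar (r + 1)) * div_diff r f) = swap_vars r (f - swap_vars r f)"
    by (simp only: div_diff_mult)
  then have "(Xvar r - Xvar (r + 1)) * swap_vars r (div_diff r f) = f - swap_vars r f"
    by (simp add: swap_vars_mult swap_vars_diff s_adj_apply algebra_simps)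
  then show ?thesis by (metis div_diff_eqI)
qed

lemma div_diff_div_diff: "div_diff r (div_diff r f) = 0"
  by (simp add: div_diff_symmetric swap_vars_div_diff)

section \<open>Commutation and braid relations\<close>

lemma swap_vars_commute: "r + 1 < t \<Longrightarrow> swap_vars r (swap_vars t f) = swap_vars t (swap_vars r f)"
  by (rule poly_mapping_eqI, simp add: lookup_swap_vars, rule arg_cong[of _ _ "lookup f"],
      rule poly_mapping_eqI) (auto simp: s_adj_apply)

lemma swap_vars_braid:
  "swap_vars r (swap_vars (Suc r) (swap_vars r f)) = swap_vars (Suc r) (swap_vars r (swap_vars (Suc r) f))"
  by (rule poly_mapping_eqI, simp add: lookup_swap_vars, rule arg_cong[of _ _ "lookup f"],
      rule poly_mapping_eqI) (auto simp: s_adj_apply)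

text \<open>With both denominators cleared, either side is a signed sum over the four products of
  the two swaps, which commute. The argument uses that each swap fixes the denominator of the other
  operator.\<close>

lemma div_diff_commute:
  assumes "r + 1 < t"
  shows "div_diff r (div_diff t f) = div_diff t (div_diff r f)"
proof -
  have main: "(Xvar r - Xvar (r + 1)) * ((Xvar t - Xvar (t + 1)) * div_diff r (div_diff t f))
    = f - swap_vars t f - swap_vars r f + swap_vars r (swap_vars t f)"
    if "r + 1 < t \<or> t + 1 < r" for r t
  proof -
    have s: "s_adj r t = t" "s_adj r (t + 1) = t + 1" using that by (auto simp: s_adj_apply)
    have "(Xvar r - Xvar (r + 1)) * ((Xvar t - Xvar (t + 1)) * div_diff r (div_diff t f))
      = (Xvar t - Xvar (t + 1)) * ((Xvar r - Xvar (r + 1)) * div_diff r (div_diff t f))"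
      by (rule mult.left_commute)
    also have "\<dots> = (Xvar t - Xvar (t + 1)) * div_diff t f
        - swap_vars r ((Xvar t - Xvar (t + 1)) * div_diff t f)"
      by (simp only: div_diff_mult[of r] swap_vars_mult swap_vars_diff swap_vars_Xvar s right_diff_distrib)
    finally show ?thesis
      by (simp only: div_diff_mult swap_vars_diff) simp
  qed
  have "(Xvar r - Xvar (r + 1)) * ((Xvar t - Xvar (t + 1)) * div_diff r (div_diff t f))
    = (Xvar r - Xvar (r + 1)) * ((Xvar t - Xvar (t + 1)) * div_diff t (div_diff r f))"
    using main[of r t] main[of t r] assms swap_vars_commute[OF assms, of f]
    by (simp only: mult.left_commute) simp
  then show ?thesis
    using Xvar_neq[of r "r + 1"] Xvar_neq[of t "t + 1"] by simp
qed

text \<open>Multiplied by a Vandermonde factor, both sides become the alternating sum over the six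
  permutations of the three variables.\<close>

lemma div_diff_braid:
  "div_diff r (div_diff (Suc r) (div_diff r f)) = div_diff (Suc r) (div_diff r (div_diff (Suc r) f))"
proof -
  define a b c where "a = Xvar r" and "b = Xvar (Suc r)" and "c = Xvar (Suc (Suc r))"
  let ?s = "swap_vars r" and ?t = "swap_vars (Suc r)"
  have sv [simp]: "?s a = b" "?s b = a" "?s c = c" "?t a = a" "?t b = c" "?t c = b"
    by (simp_all add: a_def b_def c_def s_adj_apply)
  have s: "(a - b) * div_diff r g = g - ?s g" for g
    using div_diff_mult[of r g] by (simp add: a_def b_def)
  have t: "(b - c) * div_diff (Suc r) g = g - ?t g" for g
    using div_diff_mult[of "Suc r" g] by (simp add: b_def c_def)
  note hom = swap_vars_mult swap_vars_diff
  have nz: "a - b \<noteq> 0" "a - c \<noteq> 0" "b - c \<noteq> 0"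
    unfolding a_def b_def c_def by (rule Xvar_neq; simp)+
  define alt where "alt = f - ?s f - ?t f + ?t (?s f) + ?s (?t f) - ?s (?t (?s f))"
  have "(a - b) * ((a - c) * (b - c)) * div_diff r (div_diff (Suc r) (div_diff r f)) = alt"
  proof -
    define g h k where "g = div_diff r f" and "h = div_diff (Suc r) g" and "k = div_diff r h"
    have g: "(a - b) * g = f - ?s f" and h: "(b - c) * h = g - ?t g" and k: "(a - b) * k = h - ?s h"
      by (simp_all add: g_def h_def k_def s t)
    have tg: "(a - c) * ?t g = ?t f - ?t (?s f)"
      using arg_cong[OF g, of ?t] by (simp add: hom)
    have "(a - b) * ((a - c) * (b - c)) * h = (a - c) * ((a - b) * g) - (a - b) * ((a - c) * ?t g)"
      using h by algebra
    then have H: "(a - b) * ((a - c) * (b - c)) * h = (a - c) * (f - ?s f) - (a - b) * (?t f - ?t (?s f))"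
      by (simp only: g tg)
    have "(b - a) * ((b - c) * (a - c)) * ?s h
        = (b - c) * (?s f - f) - (b - a) * (?s (?t f) - ?s (?t (?s f)))"
      using arg_cong[OF H, of ?s] by (simp add: hom)
    \<comment> \<open>The Vandermonde product changes sign under \<open>?s\<close>, so adding
      \<open>H\<close> and its image gives that product times \<open>h - ?s h\<close>. The
      coefficient of \<open>f - ?s f\<close> becomes \<open>(a - c) - (b - c)\<close>, hence the
      common factor \<open>a - b\<close>.\<close>
    with H k have "(a - b) * ((a - b) * ((a - c) * (b - c)) * k) = (a - b) * alt"
      unfolding alt_def by algebra
    then show ?thesis using nz by (simp add: k_def h_def g_def)
  qed
  moreover have "(a - b) * ((a - c) * (b - c)) * div_diff (Suc r) (div_diff r (div_diff (Suc r) f)) = alt"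
  proof -
    define g h k where "g = div_diff (Suc r) f" and "h = div_diff r g" and "k = div_diff (Suc r) h"
    have g: "(b - c) * g = f - ?t f" and h: "(a - b) * h = g - ?s g" and k: "(b - c) * k = h - ?t h"
      by (simp_all add: g_def h_def k_def s t)
    have sg: "(a - c) * ?s g = ?s f - ?s (?t f)"
      using arg_cong[OF g, of ?s] by (simp add: hom)
    have "(a - b) * ((a - c) * (b - c)) * h = (a - c) * ((b - c) * g) - (b - c) * ((a - c) * ?s g)"
      using h by algebra
    then have H: "(a - b) * ((a - c) * (b - c)) * h = (a - c) * (f - ?t f) - (b - c) * (?s f - ?s (?t f))"
      by (simp only: g sg)
    have "(a - c) * ((a - b) * (c - b)) * ?t h
        = (a - b) * (?t f - f) - (c - b) * (?t (?s f) - ?s (?t (?s f)))"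
      using arg_cong[OF H, of ?t] by (simp add: hom swap_vars_braid)
    with H k have "(b - c) * ((a - b) * ((a - c) * (b - c)) * k) = (b - c) * alt"
      unfolding alt_def by algebra
    then show ?thesis using nz by (simp add: k_def h_def g_def)
  qed
  ultimately show ?thesis using nz by (metis mult_cancel_left no_zero_divisors)
qed

subsection \<open>Schubert polynomials\<close>

definition inversions :: "nat \<Rightarrow> (nat \<Rightarrow> nat) \<Rightarrow> (nat \<times> nat) set" where
  "inversions n w = {(a, b). a \<in> {1..n} \<and> b \<in> {1..n} \<and> a < b \<and> w a > w b}"

lemma finite_inversions [simp]: "finite (inversions n w)"
  by (rule finite_subset[of _ "{1..n} \<times> {1..n}"]) (auto simp: inversions_def)

lemma perm_length_eq: "perm_length n w = card (inversions n w)"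
  by (simp add: perm_length_def inversions_def)

text \<open>A crude bound, enough for inductions on \<open>n * n - perm_length n w\<close>.\<close>

lemma perm_length_le: "perm_length n w \<le> n * n"
proof -
  have "card (inversions n w) \<le> card ({1..n} \<times> {1..n})"
    by (rule card_mono) (auto simp: inversions_def)
  then show ?thesis by (simp add: perm_length_eq)
qed

text \<open>Applying \<open>s_adj r\<close> to both positions of a pair matches the inversions of
  \<open>w \<circ> s_adj r\<close> with those of \<open>w\<close> other than
  \<open>(r, r + 1)\<close>.\<close>

lemma perm_length_swap_descent:
  assumes r: "r \<in> {1..<n}" and desc: "w (r + 1) < w r"
  shows "perm_length n w = Suc (perm_length n (w \<circ> s_adj r))"
proof -
  have mem: "s_adj r a \<in> {1..n}" if "a \<in> {1..n}" for a
    using that r by (auto simp: s_adj_apply)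
  let ?h = "\<lambda>(a, b). (s_adj r a, s_adj r b)"
  have "bij_betw ?h (inversions n (w \<circ> s_adj r)) (inversions n w - {(r, r + 1)})"
  proof (rule bij_betw_byWitness[where f' = ?h])
    have neq: "(a, b) \<noteq> (r, r + 1)" if "(a, b) \<in> inversions n (w \<circ> s_adj r)" for a b
      using that desc by (auto simp: inversions_def s_adj_apply)
    show "?h ` inversions n (w \<circ> s_adj r) \<subseteq> inversions n w - {(r, r + 1)}"
    proof clarify
      fix a b assume ab: "(a, b) \<in> inversions n (w \<circ> s_adj r)"
      then have "a < b" by (simp add: inversions_def)
      then have "s_adj r a < s_adj r b" "(s_adj r a, s_adj r b) \<noteq> (r, r + 1)"
        using neq[OF ab] by (auto simp: s_adj_apply)
      with ab mem show "(s_adj r a, s_adj r b) \<in> inversions n w - {(r, r + 1)}"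
        by (simp add: inversions_def)
    qed
    show "?h ` (inversions n w - {(r, r + 1)}) \<subseteq> inversions n (w \<circ> s_adj r)"
    proof (rule image_subsetI)
      fix p assume "p \<in> inversions n w - {(r, r + 1)}"
      then obtain a b where p: "p = (a, b)" and ab: "(a, b) \<in> inversions n w" "(a, b) \<noteq> (r, r + 1)"
        by (cases p) auto
      then have "a < b" by (simp add: inversions_def)
      with ab(2) have "s_adj r a < s_adj r b" by (auto simp: s_adj_apply)
      with ab mem show "?h p \<in> inversions n (w \<circ> s_adj r)"
        by (simp add: inversions_def p)
    qed
  qed auto
  then have "card (inversions n (w \<circ> s_adj r)) = card (inversions n w - {(r, r + 1)})"
    by (rule bij_betw_same_card)
  moreover have "(r, r + 1) \<in> inversions n w"
    using r desc by (auto simp: inversions_def)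
  ultimately show ?thesis
    unfolding perm_length_eq using card.remove[of "inversions n w" "(r, r + 1)"] by simp
qed

lemma perm_length_swap_ascent:
  assumes "r \<in> {1..<n}" and "w r < w (r + 1)"
  shows "perm_length n (w \<circ> s_adj r) = Suc (perm_length n w)"
  using perm_length_swap_descent[of r n "w \<circ> s_adj r"] assms
  by (simp add: s_adj_apply comp_assoc)

lemma perm_length_longest: "perm_length n (longest_perm n) = (\<Sum>k=1..n. n - k)"
proof -
  have "inversions n (longest_perm n) = Sigma {1..n} (\<lambda>a. {a<..n})"
    by (auto simp: inversions_def longest_perm_def)
  then show ?thesis by (simp add: perm_length_eq card_SigmaI)
qed

section \<open>Permutations of \<open>{1..n}\<close> and the longest element\<close>

lemma s_adj_permutes: "r \<in> {1..<n} \<Longrightarrow> s_adj r permutes {1..n}"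
  unfolding s_adj_def by (rule permutes_swap_id) auto

lemma comp_s_adj_permutes: "w permutes {1..n} \<Longrightarrow> r \<in> {1..<n} \<Longrightarrow> w \<circ> s_adj r permutes {1..n}"
  using permutes_compose s_adj_permutes by blast

lemma longest_perm_permutes: "longest_perm n permutes {1..n}"
  by (rule bij_imp_permutes, rule bij_betw_byWitness[where f' = "longest_perm n"])
    (auto simp: longest_perm_def)

lemma permutes_neq_Suc:
  fixes w :: "nat \<Rightarrow> nat"
  assumes "w permutes A"
  shows "w (r + 1) \<noteq> w r"
  using inj_eq[OF permutes_inj[OF assms], of "r + 1" r] by simp

text \<open>The values drop by at least one at each step. Counting steps from position 1, where the
  value is at most \<open>n\<close>, and up to position \<open>n\<close>, where it is at least 1,
  pins down every value.\<close>

lemma no_ascent_imp_longest: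
  assumes w: "w permutes {1..n}" and desc: "\<And>r. r \<in> {1..<n} \<Longrightarrow> w (r + 1) < w r"
  shows "w = longest_perm n"
proof -
  have mem: "w a \<in> {1..n}" if "a \<in> {1..n}" for a
    using permutes_in_image[OF w] that by blast
  have mono: "w (a + d) + d \<le> w a" if "1 \<le> a" "a + d \<le> n" for a d
    using that(2)
  proof (induction d)
    case (Suc d)
    with desc[of "a + d"] \<open>1 \<le> a\<close> show ?case by auto
  qed simp
  show ?thesis
  proof
    fix a
    show "w a = longest_perm n a"
    proof (cases "a \<in> {1..n}")
      case True
      have "w (1 + (a - 1)) + (a - 1) \<le> w 1" "w (a + (n - a)) + (n - a) \<le> w a"
        using True by (intro mono; simp)+
      then show ?thesis using True mem[of 1] mem[of n] by (auto simp: longest_perm_def)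
    next
      case False
      then show ?thesis using w by (auto simp: longest_perm_def permutes_def)
    qed
  qed
qed

section \<open>Polynomials reached along descending chains from the longest permutation\<close>

inductive schubert_chain :: "nat \<Rightarrow> (nat \<Rightarrow> nat) \<Rightarrow> mpoly \<Rightarrow> bool" for n where
  longest: "schubert_chain n (longest_perm n) (\<Prod>k=1..n-1. Xvar k ^ (n - k))"
| step: "schubert_chain n w P \<Longrightarrow> r \<in> {1..<n} \<Longrightarrow> w (r + 1) < w r
    \<Longrightarrow> schubert_chain n (w \<circ> s_adj r) (div_diff r P)"

lemma schubert_chain_permutes: "schubert_chain n w P \<Longrightarrow> w permutes {1..n}"
proof (induction rule: schubert_chain.induct)
  case longest
  show ?case by (rule longest_perm_permutes)
next
  case (step w P r)
  then show ?case by (intro comp_s_adj_permutes)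
qed

text \<open>Multiplying by \<open>s_adj r\<close> at an ascent increases the length. This climb ends
  at \<open>longest_perm n\<close>, and read backwards it is a chain down to
  \<open>w\<close>.\<close>

lemma schubert_chain_exists:
  assumes "w permutes {1..n}"
  shows "\<exists>P. schubert_chain n w P"
  using assms
proof (induction "n * n - perm_length n w" arbitrary: w rule: less_induct)
  case less
  show ?case
  proof (cases "\<forall>r\<in>{1..<n}. w (r + 1) < w r")
    case True
    then have "w = longest_perm n" using no_ascent_imp_longest less.prems by blast
    then show ?thesis using schubert_chain.longest by blast
  next
    case False
    then obtain r where r: "r \<in> {1..<n}" and asc: "w r < w (r + 1)"
      using permutes_neq_Suc[OF less.prems] by (meson linorder_neqE_nat)
    have "perm_length n (w \<circ> s_adj r) = Suc (perm_length n w)"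
      by (rule perm_length_swap_ascent) fact+
    with perm_length_le[of n "w \<circ> s_adj r"]
    have "n * n - perm_length n (w \<circ> s_adj r) < n * n - perm_length n w" by linarith
    with less obtain P where "schubert_chain n (w \<circ> s_adj r) P"
      using comp_s_adj_permutes[OF less.prems r] by blast
    from schubert_chain.step[OF this r] asc
    have "schubert_chain n w (div_diff r P)" by (simp add: comp_assoc s_adj_apply)
    then show ?thesis ..
  qed
qed

text \<open>Inversion of the last step, phrased through \<open>w\<close> itself: the predecessor is
  \<open>w \<circ> s_adj r\<close>, and its descent at \<open>r\<close> is an ascent of
  \<open>w\<close>.\<close>

lemma schubert_chain_cases:
  assumes "schubert_chain n w P"
  obtains "w = longest_perm n" "P = (\<Prod>k=1..n-1. Xvar k ^ (n - k))"
  | r Q where "schubert_chain n (w \<circ> s_adj r) Q" "r \<in> {1..<n}" "w r < w (r + 1)" "P = div_diff r Q"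
  using assms
proof cases
  case longest
  then show thesis by (rule that(1))
next
  case (step u Q r)
  then show thesis using that(2)[of r Q] by (simp add: comp_assoc s_adj_apply)
qed

lemma longest_perm_descent: "r \<in> {1..<n} \<Longrightarrow> longest_perm n (r + 1) < longest_perm n r"
  by (auto simp: longest_perm_def)

text \<open>Two last steps at \<open>r\<close> and \<open>t\<close> are compared through a common predecessor of \<open>w\<close>,
  obtained by sorting the positions \<open>r, r + 1, t, t + 1\<close> of \<open>w\<close> into descending order.\<close>

lemma schubert_chain_unique:
  assumes "schubert_chain n w P" and "schubert_chain n w Q"
  shows "P = Q"
  using assms
proof (induction "n * n - perm_length n w" arbitrary: w P Q rule: less_induct)
  case less
  have IH: "P' = Q'" if "schubert_chain n (w \<circ> s_adj r) P'" "schubert_chain n (w \<circ> s_adj r) Q'"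
    "r \<in> {1..<n}" "w r < w (r + 1)" for r P' Q'
  proof -
    have "perm_length n (w \<circ> s_adj r) = Suc (perm_length n w)"
      using that(3,4) by (rule perm_length_swap_ascent)
    with perm_length_le[of n "w \<circ> s_adj r"]
    have "n * n - perm_length n (w \<circ> s_adj r) < n * n - perm_length n w" by linarith
    from less(1)[OF this that(1,2)] show ?thesis .
  qed
  have w: "w permutes {1..n}" using less.prems(1) by (rule schubert_chain_permutes)
  have ordered: "div_diff r P' = div_diff t Q'"
    if P': "schubert_chain n (w \<circ> s_adj r) P'" "r \<in> {1..<n}" "w r < w (r + 1)"
      and Q': "schubert_chain n (w \<circ> s_adj t) Q'" "t \<in> {1..<n}" "w t < w (t + 1)"
      and "r < t" for r t P' Q'
  proof (cases "t = r + 1")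
    case False
    with \<open>r < t\<close> have far: "r + 1 < t" by simp
    have comm: "s_adj r \<circ> s_adj t = s_adj t \<circ> s_adj r"
      using far by (auto simp: fun_eq_iff s_adj_apply)
    let ?z = "w \<circ> s_adj r \<circ> s_adj t"
    have "?z permutes {1..n}" using w P'(2) Q'(2) by (intro comp_s_adj_permutes)
    then obtain R where R: "schubert_chain n ?z R" using schubert_chain_exists by blast
    have "schubert_chain n (?z \<circ> s_adj t) (div_diff t R)"
      using R Q'(2) by (rule schubert_chain.step) (use Q' far in \<open>auto simp: s_adj_apply\<close>)
    then have "P' = div_diff t R" using IH[OF P'(1) _ P'(2,3)] by (simp add: comp_assoc)
    moreover have "schubert_chain n (?z \<circ> s_adj r) (div_diff r R)"
      using R P'(2) by (rule schubert_chain.step) (use P' far in \<open>auto simp: s_adj_apply\<close>)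
    then have "schubert_chain n (w \<circ> s_adj t) (div_diff r R)"
      by (metis comm comp_assoc comp_id s_adj_comp_s_adj)
    then have "Q' = div_diff r R" using IH[OF Q'(1) _ Q'(2,3)] by simp
    ultimately show ?thesis using div_diff_commute[OF far] by simp
  next
    case True
    have braid: "s_adj r \<circ> s_adj t \<circ> s_adj r = s_adj t \<circ> s_adj r \<circ> s_adj t"
      using True by (auto simp: fun_eq_iff s_adj_apply)
    let ?z = "w \<circ> s_adj r \<circ> s_adj t \<circ> s_adj r"
    have "?z permutes {1..n}" using w P'(2) Q'(2) by (intro comp_s_adj_permutes)
    then obtain R where R: "schubert_chain n ?z R" using schubert_chain_exists by blast
    have z: "?z = w \<circ> s_adj t \<circ> s_adj r \<circ> s_adj t" using braid by (metis comp_assoc)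
    have "schubert_chain n (?z \<circ> s_adj r) (div_diff r R)"
      using R P'(2) by (rule schubert_chain.step) (use P' Q' True in \<open>auto simp: s_adj_apply\<close>)
    then have "schubert_chain n (w \<circ> s_adj r \<circ> s_adj t) (div_diff r R)"
      by (simp add: comp_assoc)
    then have "schubert_chain n (w \<circ> s_adj r \<circ> s_adj t \<circ> s_adj t) (div_diff t (div_diff r R))"
      using Q'(2) by (rule schubert_chain.step) (use P' Q' True in \<open>auto simp: s_adj_apply\<close>)
    then have "P' = div_diff t (div_diff r R)" using IH[OF P'(1) _ P'(2,3)] by (simp add: comp_assoc)
    moreover have "schubert_chain n (?z \<circ> s_adj t) (div_diff t R)"
      using R Q'(2) by (rule schubert_chain.step) (use P' Q' True in \<open>auto simp: s_adj_apply\<close>)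
    then have "schubert_chain n (w \<circ> s_adj t \<circ> s_adj r) (div_diff t R)"
      unfolding z by (simp add: comp_assoc)
    then have "schubert_chain n (w \<circ> s_adj t \<circ> s_adj r \<circ> s_adj r) (div_diff r (div_diff t R))"
      using P'(2) by (rule schubert_chain.step) (use P' Q' True in \<open>auto simp: s_adj_apply\<close>)
    then have "Q' = div_diff r (div_diff t R)" using IH[OF Q'(1) _ Q'(2,3)] by (simp add: comp_assoc)
    ultimately show ?thesis using div_diff_braid[of r R] True by simp
  qed
  show ?case
  proof (cases rule: schubert_chain_cases[OF less.prems(1)])
    case 1
    show ?thesis
    proof (cases rule: schubert_chain_cases[OF less.prems(2)])
      case (2 t Q')
      with 1 longest_perm_descent[of t n] show ?thesis by simp
    qed (simp add: 1)
  next
    case r: (2 r P')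
    show ?thesis
    proof (cases rule: schubert_chain_cases[OF less.prems(2)])
      case 1
      with r longest_perm_descent[of r n] show ?thesis by simp
    next
      case t: (2 t Q')
      consider "r = t" | "r < t" | "t < r" by linarith
      then show ?thesis
      proof cases
        case 1
        with IH[OF r(1) _ r(2,3)] t(1) show ?thesis by (simp add: r(4) t(4))
      next
        case 2
        with ordered[OF r(1-3) t(1-3)] show ?thesis by (simp only: r(4) t(4))
      next
        case 3
        with ordered[OF t(1-3) r(1-3)] show ?thesis by (simp only: r(4) t(4))
      qed
    qed
  qed
qed

section \<open>Descending words and chains agree\<close>

lemma s_word_Nil [simp]: "s_word [] = id"
  by (simp add: s_word_def)

lemma s_word_append: "s_word (xs @ ys) = s_word xs \<circ> s_word ys"
  by (induction xs) (simp_all add: s_word_def comp_assoc)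

lemma s_word_Cons: "s_word (x # xs) = s_adj x \<circ> s_word xs"
  by (simp add: s_word_def)

lemma s_word_snoc: "s_word (xs @ [x]) = s_word xs \<circ> s_adj x"
  by (simp add: s_word_append s_word_Cons)

text \<open>The length condition on prefixes becomes a descent at each step, because an ascent would
  raise the length. Chains keep only this local condition, which suits rule induction.\<close>

lemma descending_word_imp_chain:
  "descending_word n w rs \<Longrightarrow> schubert_chain n w (fold div_diff rs (\<Prod>k=1..n-1. Xvar k ^ (n - k)))"
proof (induction rs arbitrary: w rule: rev_induct)
  case Nil
  then show ?case using schubert_chain.longest[of n] by (simp add: descending_word_def)
next
  case (snoc r rs)
  let ?u = "longest_perm n \<circ> s_word rs"
  have r: "r \<in> {1..<n}" and w: "w = ?u \<circ> s_adj r"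
    using snoc.prems by (auto simp: descending_word_def s_word_snoc comp_assoc)
  have len: "perm_length n (longest_perm n \<circ> s_word (take p (rs @ [r]))) + p = perm_length n (longest_perm n)"
    if "p \<in> {1..Suc (length rs)}" for p
    using snoc.prems that by (auto simp: descending_word_def)
  have "descending_word n ?u rs"
    unfolding descending_word_def
  proof (intro conjI ballI)
    show "set rs \<subseteq> {1..<n}" using snoc.prems by (auto simp: descending_word_def)
    fix p assume "p \<in> {1..length rs}"
    then show "perm_length n (longest_perm n \<circ> s_word (take p rs)) + p = perm_length n (longest_perm n)"
      using len[of p] by simp
  qed simp
  then have u: "schubert_chain n ?u (fold div_diff rs (\<Prod>k=1..n-1. Xvar k ^ (n - k)))"
    by (rule snoc.IH)
  \<comment> \<open>For empty \<open>rs\<close> the index 0 lies outside the range of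
    \<open>len\<close>, but the equation is then trivial.\<close>
  have len_u: "perm_length n ?u + length rs = perm_length n (longest_perm n)"
    using len[of "length rs"] by (cases rs) auto
  have len_w: "perm_length n w + Suc (length rs) = perm_length n (longest_perm n)"
    using len[of "Suc (length rs)"] w by (simp add: s_word_snoc o_assoc)
  have "\<not> ?u r < ?u (r + 1)"
  proof
    assume "?u r < ?u (r + 1)"
    with r have "perm_length n (?u \<circ> s_adj r) = Suc (perm_length n ?u)"
      by (rule perm_length_swap_ascent)
    with w len_u len_w show False by simp
  qed
  then have "?u (r + 1) < ?u r"
    using permutes_neq_Suc[OF schubert_chain_permutes[OF u], of r] by linarith
  with u r have "schubert_chain n (?u \<circ> s_adj r)
      (div_diff r (fold div_diff rs (\<Prod>k=1..n-1. Xvar k ^ (n - k))))"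
    by (rule schubert_chain.step)
  moreover have "fold div_diff (rs @ [r]) Q = div_diff r (fold div_diff rs Q)" for Q
    by simp
  ultimately show ?case by (simp only: w)
qed

lemma chain_imp_descending_word:
  "schubert_chain n w P \<Longrightarrow>
    \<exists>rs. descending_word n w rs \<and> P = fold div_diff rs (\<Prod>k=1..n-1. Xvar k ^ (n - k))"
proof (induction rule: schubert_chain.induct)
  case longest
  show ?case by (rule exI[of _ "[]"]) (simp add: descending_word_def)
next
  case (step w P r)
  then obtain rs where rs: "descending_word n w rs" "P = fold div_diff rs (\<Prod>k=1..n-1. Xvar k ^ (n - k))"
    by blast
  have w: "w = longest_perm n \<circ> s_word rs" using rs(1) by (simp add: descending_word_def)
  have len: "perm_length n (longest_perm n \<circ> s_word (take p rs)) + p = perm_length n (longest_perm n)"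
    if "p \<in> {0..length rs}" for p
    using rs(1) that by (cases "p = 0") (auto simp: descending_word_def)
  have last: "perm_length n (w \<circ> s_adj r) + Suc (length rs) = perm_length n (longest_perm n)"
  proof -
    have "perm_length n w = Suc (perm_length n (w \<circ> s_adj r))"
      by (rule perm_length_swap_descent) fact+
    then show ?thesis using len[of "length rs"] by (simp add: w)
  qed
  have "descending_word n (w \<circ> s_adj r) (rs @ [r])"
    unfolding descending_word_def
  proof (intro conjI ballI)
    show "set (rs @ [r]) \<subseteq> {1..<n}" using rs(1) step.hyps(2) by (auto simp: descending_word_def)
    show "w \<circ> s_adj r = longest_perm n \<circ> s_word (rs @ [r])"
      by (simp add: w s_word_snoc comp_assoc)
    fix p assume "p \<in> {1..length (rs @ [r])}"
    then show "perm_length n (longest_perm n \<circ> s_word (take p (rs @ [r]))) + p = perm_length n (longest_perm n)"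
      using len[of p] last w by (cases "p = Suc (length rs)") (auto simp: s_word_snoc comp_assoc)
  qed
  moreover have "div_diff r P = fold div_diff (rs @ [r]) (\<Prod>k=1..n-1. Xvar k ^ (n - k))"
    using rs(2) by simp
  ultimately show ?case by (intro exI[of _ "rs @ [r]"] conjI)
qed

text \<open>Words and chains describe the same polynomials, and chains determine theirs uniquely, so
  the definite description is met by \<open>P\<close>.\<close>

lemma schubert_eqI:
  assumes "schubert_chain n w P"
  shows "schubert n w = P"
proof -
  have "(\<exists>rs. descending_word n w rs \<and> Q = fold div_diff rs (\<Prod>k=1..n-1. Xvar k ^ (n - k)))
      \<longleftrightarrow> schubert_chain n w Q" for Q
    using descending_word_imp_chain chain_imp_descending_word by blast
  then show ?thesis
    unfolding schubert_def using assms schubert_chain_unique by (simp add: the_equality)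
qed

section \<open>Divided differences of Schubert polynomials\<close>

lemma schubert_chain_schubert: "w permutes {1..n} \<Longrightarrow> schubert_chain n w (schubert n w)"
  by (metis schubert_chain_exists schubert_eqI)

lemma div_diff_schubert_descent:
  assumes "w permutes {1..n}" "r \<in> {1..<n}" "w (r + 1) < w r"
  shows "div_diff r (schubert n w) = schubert n (w \<circ> s_adj r)"
  by (rule schubert_eqI[symmetric], rule schubert_chain.step, rule schubert_chain_schubert) fact+

text \<open>At an ascent the polynomial is itself an image of \<open>div_diff r\<close>, namely that
  of the polynomial of \<open>w \<circ> s_adj r\<close>, and this operator squares to zero.\<close>

lemma div_diff_schubert_ascent:
  assumes "w permutes {1..n}" "r \<in> {1..<n}" "w r < w (r + 1)"
  shows "div_diff r (schubert n w) = 0"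
proof -
  have "div_diff r (schubert n (w \<circ> s_adj r)) = schubert n (w \<circ> s_adj r \<circ> s_adj r)"
    using assms by (intro div_diff_schubert_descent comp_s_adj_permutes) (auto simp: s_adj_apply)
  then show ?thesis using div_diff_div_diff[of r "schubert n (w \<circ> s_adj r)"]
    by (simp add: comp_assoc)
qed

text \<open>The chain from the staircase of \<open>S\<^bsub>m+1\<^esub>\<close> to that of \<open>S\<^sub>m\<close> applies the operators
  with index \<open>1, \<dots>, m\<close>; every intermediate polynomial is a monomial.\<close>

lemma schubert_chain_staircase:
  assumes "m \<le> n"
  shows "schubert_chain n (longest_perm m) (\<Prod>k=1..m. Xvar k ^ (m - k))"
  using assms
proof (induction rule: inc_induct)
  case base
  have "(\<Prod>k=1..n. Xvar k ^ (n - k)) = (\<Prod>k=1..n-1. Xvar k ^ (n - k))"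
    by (cases n) auto
  then show ?case using schubert_chain.longest[of n] by simp
next
  case (step m)
  \<comment> \<open>In one-line notation \<open>u q\<close> is
    \<open>m, ..., m+1-q, m+1, m-q, ..., 1\<close>, the product of
    \<open>longest_perm (m + 1)\<close> with \<open>s_1 ... s_q\<close>. The vector
    \<open>e q\<close> is the staircase of \<open>m + 1\<close> with its first \<open>q\<close>
    entries lowered by one.\<close>
  define u where "u q a = (if a = 0 \<or> m + 1 < a then a else if a \<le> q then m + 1 - a
    else if a = q + 1 then m + 1 else m + 2 - a)" for q a :: nat
  define e where "e q a = (if a \<le> q then m - a else m + 1 - a)" for q a :: nat
  have "schubert_chain n (u q) (\<Prod>k=1..m+1. Xvar k ^ e q k)" if "q \<le> m" for q
    using that
  proof (induction q)
    case 0
    have "u 0 = longest_perm (Suc m)" by (auto simp: u_def longest_perm_def)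
    moreover have "(\<Prod>k=1..m+1. Xvar k ^ e 0 k) = (\<Prod>k=1..Suc m. Xvar k ^ (Suc m - k))"
      by (intro prod.cong) (auto simp: e_def)
    ultimately show ?case using step.IH by simp
  next
    case (Suc q)
    have u: "u (Suc q) = u q \<circ> s_adj (Suc q)"
      using Suc.prems by (auto simp: u_def s_adj_apply fun_eq_iff)
    \<comment> \<open>Here \<open>x_(q+1)\<close> and \<open>x_(q+2)\<close> both have exponent
      \<open>m - q - 1\<close>, so \<open>?M\<close> is symmetric in them. The previous monomial is
      \<open>?M\<close> times \<open>x_(q+1)\<close>.\<close>
    let ?M = "\<Prod>k=1..m+1. Xvar k ^ e (Suc q) k"
    have "swap_vars (Suc q) ?M = (\<Prod>k=1..m+1. Xvar (s_adj (Suc q) k) ^ e (Suc q) k)"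
      by (simp only: swap_vars_prod swap_vars_power swap_vars_Xvar)
    also have "\<dots> = ?M"
    proof (rule prod.reindex_bij_witness[of _ "s_adj (Suc q)" "s_adj (Suc q)"])
      fix k assume k: "k \<in> {1..m+1}"
      show "s_adj (Suc q) k \<in> {1..m+1}" "s_adj (Suc q) k \<in> {1..m+1}"
        using k Suc.prems by (auto simp: s_adj_apply)
      show "Xvar (s_adj (Suc q) k) ^ e (Suc q) (s_adj (Suc q) k) = Xvar (s_adj (Suc q) k) ^ e (Suc q) k"
        using k Suc.prems by (auto simp: s_adj_apply e_def)
    qed simp_all
    finally have sym: "swap_vars (Suc q) ?M = ?M" .
    have "(\<Prod>k=1..m+1. Xvar k ^ e q k) = (\<Prod>k=1..m+1. Xvar k ^ e (Suc q) k * (if k = Suc q then Xvar k else 1))"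
      using Suc.prems by (intro prod.cong) (auto simp: e_def power_Suc2[symmetric] Suc_diff_Suc simp del: power_Suc)
    also have "\<dots> = ?M * Xvar (Suc q)"
      using Suc.prems by (simp only: prod.distrib) (simp add: prod.delta')
    finally have "div_diff (Suc q) (\<Prod>k=1..m+1. Xvar k ^ e q k) = ?M * div_diff (Suc q) (Xvar (Suc q))"
      using div_diff_symmetric_mult[OF sym] by simp
    also have "div_diff (Suc q) (Xvar (Suc q)) = 1"
      by (rule div_diff_eqI) (simp add: s_adj_apply)
    finally have "div_diff (Suc q) (\<Prod>k=1..m+1. Xvar k ^ e q k) = ?M" by simp
    moreover have "schubert_chain n (u q \<circ> s_adj (Suc q)) (div_diff (Suc q) (\<Prod>k=1..m+1. Xvar k ^ e q k))"
    proof (rule schubert_chain.step)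
      show "schubert_chain n (u q) (\<Prod>k=1..m+1. Xvar k ^ e q k)" using Suc by simp
      show "Suc q \<in> {1..<n}" "u q (Suc q + 1) < u q (Suc q)"
        using Suc.prems step.hyps by (auto simp: u_def)
    qed
    ultimately show ?case by (simp only: u)
  qed
  from this[of m] have "schubert_chain n (u m) (\<Prod>k=1..m+1. Xvar k ^ e m k)" by simp
  moreover have "u m = longest_perm m" by (auto simp: u_def longest_perm_def)
  moreover have "(\<Prod>k=1..m+1. Xvar k ^ e m k) = (\<Prod>k=1..m. Xvar k ^ (m - k))"
    by (simp add: e_def)
  ultimately show ?case by simp
qed

text \<open>The case \<open>m = 0\<close> of the staircase chain, where the product is
  empty.\<close>

lemma schubert_id: "schubert n id = 1"
proof -
  have "longest_perm 0 = id" by (auto simp: longest_perm_def)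
  then show ?thesis using schubert_chain_staircase[of 0 n] by (intro schubert_eqI) simp
qed

section \<open>Degree and support of Schubert polynomials\<close>

definition staircase_exps :: "nat \<Rightarrow> nat \<Rightarrow> (nat \<Rightarrow>\<^sub>0 nat) set" where
  "staircase_exps n d = {m. (\<forall>k. lookup m k \<le> (if k = 0 then 0 else n - k)) \<and>
     (\<Sum>k=1..n. lookup m k) = d}"

text \<open>Both new exponents lie strictly below a maximum that is at most \<open>n - r\<close>, so
  they are at most \<open>n - (r + 1)\<close>, the smaller of the two bounds. The total degree drops
  by one.\<close>

lemma reduced_exps_staircase:
  assumes m: "m \<in> staircase_exps n (Suc d)" and r: "r \<in> {1..<n}" and u: "u \<in> reduced_exps r m"
  shows "u \<in> staircase_exps n d"
proof -
  let ?l = lookup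
  have m1: "?l m k \<le> (if k = 0 then 0 else n - k)" for k
    using m by (simp add: staircase_exps_def)
  have u1: "?l u k = ?l m k" if "k \<noteq> r" "k \<noteq> r + 1" for k
    using u that by (simp add: reduced_exps_def)
  have u2: "?l u r + ?l u (r + 1) + 1 = ?l m r + ?l m (r + 1)"
    and u3: "max (?l u r) (?l u (r + 1)) < max (?l m r) (?l m (r + 1))"
    using u by (auto simp: reduced_exps_def)
  have bound: "?l u k \<le> (if k = 0 then 0 else n - k)" for k
    using m1[of k] m1[of r] m1[of "r + 1"] u1[of k] u3 r by (cases "k = r"; cases "k = r + 1") (auto split: if_splits)
  have split: "(\<Sum>k=1..n. f k) = f r + f (r + 1) + (\<Sum>k\<in>{1..n} - {r, r + 1}. f k)" for f :: "nat \<Rightarrow> nat"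
  proof -
    have "(\<Sum>k=1..n. f k) = (\<Sum>k\<in>{r, r + 1}. f k) + (\<Sum>k\<in>{1..n} - {r, r + 1}. f k)"
      using r by (intro sum.subset_diff[THEN trans, OF _ _ add.commute]) auto
    then show ?thesis by simp
  qed
  have "(\<Sum>k\<in>{1..n} - {r, r + 1}. ?l u k) = (\<Sum>k\<in>{1..n} - {r, r + 1}. ?l m k)"
    using u1 by (intro sum.cong) auto
  then have "(\<Sum>k=1..n. ?l u k) + 1 = (\<Sum>k=1..n. ?l m k)"
    using u2 split[of "?l u"] split[of "?l m"] by linarith
  then show ?thesis using bound m by (auto simp: staircase_exps_def)
qed

lemma keys_prod_Xvar_power:
  assumes "finite A"
  shows "keys (\<Prod>k\<in>A. Xvar k ^ e k) \<subseteq> {m. \<forall>k. lookup m k = (if k \<in> A then e k else 0)}"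
  using assms
proof (induction A rule: finite_induct)
  case (insert a A)
  have "keys (\<Prod>k\<in>insert a A. Xvar k ^ e k)
      \<subseteq> {b + c | b c. b \<in> keys (Xvar a ^ e a) \<and> c \<in> keys (\<Prod>k\<in>A. Xvar k ^ e k)}"
    unfolding prod.insert[OF insert.hyps] by (rule keys_mult)
  also have "\<dots> \<subseteq> {m. \<forall>k. lookup m k = (if k \<in> insert a A then e k else 0)}"
  proof clarify
    fix b c k
    assume b: "b \<in> keys (Xvar a ^ e a)" and c: "c \<in> keys (\<Prod>k\<in>A. Xvar k ^ e k)"
    from b have "b = Poly_Mapping.single a (e a)" by (simp add: Xvar_power)
    moreover have "lookup c k = (if k \<in> A then e k else 0)"
      using c insert.IH by blast
    ultimately show "lookup (b + c) k = (if k \<in> insert a A then e k else 0)"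
      using insert.hyps by (auto simp: lookup_add lookup_single when_def)
  qed
  finally show ?case .
qed simp

text \<open>The polynomial of \<open>w\<close> is homogeneous of degree the length of
  \<open>w\<close>, and its monomials divide the staircase monomial. In particular
  \<open>x_n\<close> does not occur.\<close>

lemma keys_schubert_chain:
  "schubert_chain n w P \<Longrightarrow> keys P \<subseteq> staircase_exps n (perm_length n w)"
proof (induction rule: schubert_chain.induct)
  case longest
  have "{m. \<forall>k. lookup m k = (if k \<in> {1..n - 1} then n - k else 0)}
      \<subseteq> staircase_exps n (perm_length n (longest_perm n))"
  proof clarify
    fix m assume m: "\<forall>k. lookup m k = (if k \<in> {1..n - 1} then n - k else 0)"
    have "(\<Sum>k=1..n. lookup m k) = (\<Sum>k=1..n. n - k)"
      by (rule sum.cong) (auto simp: m)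
    then show "m \<in> staircase_exps n (perm_length n (longest_perm n))"
      by (simp add: staircase_exps_def perm_length_longest m)
  qed
  then show ?case using keys_prod_Xvar_power[of "{1..n - 1}" "\<lambda>k. n - k"] by blast
next
  case (step w P r)
  have "perm_length n w = Suc (perm_length n (w \<circ> s_adj r))"
    by (rule perm_length_swap_descent) fact+
  then show ?case
    using keys_div_diff[of r P] step.IH reduced_exps_staircase[OF _ step.hyps(2)] by fastforce
qed

subsection \<open>The alternating sum\<close>

definition truncated_exps :: "nat \<Rightarrow> (nat \<Rightarrow>\<^sub>0 nat) set" where
  "truncated_exps n = {m. m \<noteq> 0 \<and> keys m \<subseteq> {1..<n}}"

text \<open>Vanishing divided differences make the support stable under all adjacent swaps. The
  absence of \<open>x_n\<close> then spreads downwards to \<open>x_1\<close>, which leaves only the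
  constant monomial, excluded by \<open>truncated_exps\<close>.\<close>

lemma eq_0_if_div_diff_eq_0:
  assumes keys: "keys f \<subseteq> truncated_exps n"
    and dd: "\<And>r. r \<in> {1..<n} \<Longrightarrow> div_diff r f = 0"
  shows "f = 0"
proof -
  have swap: "swap_exps r m \<in> keys f" if "m \<in> keys f" "r \<in> {1..<n}" for m r
  proof -
    have "swap_vars r f = f" using div_diff_mult[of r f] dd[OF that(2)] by simp
    then show ?thesis using that(1) lookup_swap_vars[of r f m] by (simp add: in_keys_iff)
  qed
  have no_var: "lookup m k = 0" if "1 \<le> k" "k \<le> n" "m \<in> keys f" for m k
    using that(2,1,3)
  proof (induction arbitrary: m rule: inc_induct)
    case base
    then have "keys m \<subseteq> {1..<n}" using keys by (auto simp: truncated_exps_def)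
    then have "n \<notin> keys m" by auto
    then show ?case by (simp add: in_keys_iff)
  next
    case (step k)
    then have "lookup (swap_exps k m) (Suc k) = 0" by (intro step.IH swap) auto
    then show ?case by (simp add: s_adj_apply)
  qed
  have "keys f = {}"
  proof (rule ccontr)
    assume "keys f \<noteq> {}"
    then obtain m where m: "m \<in> keys f" by blast
    then have "m \<in> truncated_exps n" using keys by blast
    moreover have "keys m = {}"
    proof (rule ccontr)
      assume "keys m \<noteq> {}"
      then obtain k where k: "k \<in> keys m" by blast
      with \<open>m \<in> truncated_exps n\<close> have "k \<in> {1..<n}" by (auto simp: truncated_exps_def)
      with no_var[OF _ _ m, of k] k show False by (simp add: in_keys_iff)
    qed
    ultimately show False by (simp add: truncated_exps_def)
  qed
  then show ?thesis by simp
qed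

text \<open>A descent makes the length, hence the degree, positive and so rules out a constant term.
  The staircase bound rules out \<open>x_n\<close>.\<close>

lemma keys_schubert:
  assumes w: "w permutes {1..n}" and "r \<in> {1..<n}" and "w (r + 1) < w r"
  shows "keys (schubert n w) \<subseteq> truncated_exps n"
proof
  fix m assume m: "m \<in> keys (schubert n w)"
  obtain d where d: "perm_length n w = Suc d"
    using perm_length_swap_descent[OF assms(2,3)] by blast
  have "m \<in> staircase_exps n (Suc d)"
    using keys_schubert_chain[OF schubert_chain_schubert[OF w]] m d by auto
  then have bound: "\<And>k. lookup m k \<le> (if k = 0 then 0 else n - k)"
    and sum: "(\<Sum>k=1..n. lookup m k) = Suc d"
    by (auto simp: staircase_exps_def)
  have "keys m \<subseteq> {1..<n}"
  proof
    fix k assume "k \<in> keys m"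
    with bound[of k] show "k \<in> {1..<n}" by (auto simp: in_keys_iff split: if_splits)
  qed
  moreover have "m \<noteq> 0" using sum by auto
  ultimately show "m \<in> truncated_exps n" by (simp add: truncated_exps_def)
qed

text \<open>Exponents are natural numbers, so adding to a nonzero vector cannot cancel it. The left
  factor may have a constant term, to cover empty products and signs.\<close>

lemma keys_mult_truncated:
  assumes "keys f \<subseteq> insert 0 (truncated_exps n)"
    and "keys g \<subseteq> truncated_exps n"
  shows "keys (f * g) \<subseteq> truncated_exps n"
proof
  fix m assume "m \<in> keys (f * g)"
  then obtain a b where m: "m = a + b" "a \<in> insert 0 (truncated_exps n)" "b \<in> truncated_exps n"
    using keys_mult[of f g] assms by blast
  have "b \<noteq> 0" using m by (simp add: truncated_exps_def)
  then obtain k where "lookup b k \<noteq> 0"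
    by (metis lookup_zero poly_mapping_eqI)
  then have "lookup m k \<noteq> 0" by (simp add: m lookup_add)
  then have "m \<noteq> 0" by auto
  moreover have "keys m \<subseteq> {1..<n}"
    using m keys_add[of a b] by (auto simp: truncated_exps_def)
  ultimately show "m \<in> truncated_exps n" by (simp add: truncated_exps_def)
qed

lemma keys_Xvar: "k \<in> {1..<n} \<Longrightarrow> keys (Xvar k) \<subseteq> truncated_exps n"
  by (auto simp: Xvar_def truncated_exps_def dest: arg_cong[of _ _ keys])

lemma keys_f_poly:
  assumes "j \<le> i" "i < n"
  shows "keys (f_poly i j) \<subseteq> truncated_exps n"
proof -
  have diff: "keys (Xvar k - Xvar l) \<subseteq> truncated_exps n" if "k \<in> {1..<n}" "l \<in> {1..<n}" for k l
    using that keys_Xvar keys_diff[of "Xvar k" "Xvar l"] by blast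
  have prod: "keys (\<Prod>l\<in>A. Xvar k - Xvar l) \<subseteq> insert 0 (truncated_exps n)"
    if "k \<in> {1..<n}" "A \<subseteq> {1..<n}" for k A
    using that(2)
  proof (induction A rule: infinite_finite_induct)
    case (insert l A)
    then have "keys ((\<Prod>l\<in>A. Xvar k - Xvar l) * (Xvar k - Xvar l)) \<subseteq> truncated_exps n"
      using that(1) by (intro keys_mult_truncated diff) auto
    with insert.hyps show ?case by (auto simp: mult.commute)
  qed auto
  have "keys ((\<Prod>l=j+1..i. Xvar k - Xvar l) * Xvar k) \<subseteq> truncated_exps n"
    if "k \<in> {1..j}" for k
    using that assms by (intro keys_mult_truncated prod keys_Xvar) auto
  then show ?thesis
    unfolding f_poly_def using keys_sum by (rule order.trans[rotated, OF UN_least])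
qed

section \<open>One-line form of the permutations \<open>w_perm i j k\<close>\<close>

lemma s_word_upt:
  "p \<le> q \<Longrightarrow> s_word [p..<q] a = (if a = q then p else if p \<le> a \<and> a < q then a + 1 else a)"
proof (induction q arbitrary: a rule: dec_induct)
  case (step q)
  then show ?case by (auto simp: s_word_snoc s_adj_apply)
qed simp

lemma s_word_rev_upt:
  "p \<le> q \<Longrightarrow> s_word (rev [p..<q]) a = (if a = p then q else if p < a \<and> a \<le> q then a - 1 else a)"
proof (induction q arbitrary: a rule: dec_induct)
  case (step q)
  then show ?case by (auto simp: s_word_Cons s_adj_apply)
qed simp

text \<open>Positions \<open>j, ..., i\<close> carry the values
  \<open>i-k+1, j, ..., i-k-1, i-k+2, ..., i, i-k\<close>. For \<open>j + 1 < i\<close> there is a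
  descent at \<open>j\<close> exactly when \<open>k < i - j\<close>, one at \<open>i - 1\<close>
  exactly when \<open>k > 1\<close>, and no other.\<close>

lemma w_perm_apply:
  assumes "1 \<le> k" "k \<le> i - j"
  shows "w_perm i j k a = (if a = j then i - k + 1 else if j < a \<and> a \<le> i - k then a - 1
    else if i - k < a \<and> a < i then a + 1 else if a = i then i - k else a)"
  using assms by (auto simp: w_perm_def s_word_upt s_word_rev_upt simp del: upt_Suc)

lemma s_word_permutes: "set rs \<subseteq> {1..<n} \<Longrightarrow> s_word rs permutes {1..n}"
proof (induction rs)
  case (Cons r rs)
  then have "s_adj r \<circ> s_word rs permutes {1..n}"
    by (intro permutes_compose s_adj_permutes) auto
  then show ?case by (simp only: s_word_Cons)
qed (simp add: permutes_id)

lemma w_perm_permutes: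
  assumes "1 \<le> j" "1 \<le> k" "k \<le> i - j" "i \<le> n"
  shows "w_perm i j k permutes {1..n}"
  unfolding w_perm_def using assms by (intro permutes_compose s_word_permutes) auto

section \<open>Divided differences of the alternating sum\<close>

definition alt_sum :: "nat \<Rightarrow> nat \<Rightarrow> nat \<Rightarrow> mpoly" where
  "alt_sum n i j = (\<Sum>k=1..i-j. (-1) ^ (k - 1) * schubert n (w_perm i j k))"

lemma swap_vars_sign: "swap_vars r ((-1) ^ k) = (-1) ^ k"
  by (simp add: swap_vars_power swap_vars_minus)

lemma div_diff_alt_sum:
  "div_diff r (alt_sum n i j) = (\<Sum>k=1..i-j. (-1) ^ (k - 1) * div_diff r (schubert n (w_perm i j k)))"
  by (simp add: alt_sum_def div_diff_sum div_diff_symmetric_mult swap_vars_sign)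

lemma div_diff_alt_sum_other:
  assumes "1 \<le> j" "j < i" "i \<le> n" "r \<in> {1..<n}" "r \<noteq> j" "r \<noteq> i - 1"
  shows "div_diff r (alt_sum n i j) = 0"
  unfolding div_diff_alt_sum
proof (intro sum.neutral ballI)
  fix k assume k: "k \<in> {1..i-j}"
  have "w_perm i j k r < w_perm i j k (r + 1)"
    using assms k by (auto simp: w_perm_apply)
  then have "div_diff r (schubert n (w_perm i j k)) = 0"
    using assms k by (intro div_diff_schubert_ascent w_perm_permutes) auto
  then show "(-1) ^ (k - 1) * div_diff r (schubert n (w_perm i j k)) = 0" by simp
qed

text \<open>The term \<open>k = 1\<close> has an ascent at \<open>i - 1\<close> and vanishes. Term
  \<open>k + 1\<close> descends to term \<open>k\<close> for \<open>i - 1\<close>, and this index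
  shift produces the minus sign.\<close>

lemma div_diff_alt_sum_last:
  assumes "1 \<le> j" "j < i - 1" "i \<le> n"
  shows "div_diff (i - 1) (alt_sum n i j) = - alt_sum n (i - 1) j"
proof -
  let ?t = "\<lambda>k. (-1) ^ (k - 1) * div_diff (i - 1) (schubert n (w_perm i j k))"
  have first: "div_diff (i - 1) (schubert n (w_perm i j 1)) = 0"
    using assms by (intro div_diff_schubert_ascent w_perm_permutes) (auto simp: w_perm_apply)
  have rest: "?t (Suc k) = - ((-1) ^ (k - 1) * schubert n (w_perm (i - 1) j k))" if k: "k \<in> {1..i - 1 - j}" for k
  proof -
    have "w_perm i j (Suc k) \<circ> s_adj (i - 1) = w_perm (i - 1) j k"
      using assms k by (auto simp: fun_eq_iff w_perm_apply s_adj_apply)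
    moreover have "div_diff (i - 1) (schubert n (w_perm i j (Suc k))) = schubert n (w_perm i j (Suc k) \<circ> s_adj (i - 1))"
      using assms k by (intro div_diff_schubert_descent w_perm_permutes) (auto simp: w_perm_apply)
    moreover have "(-1 :: mpoly) ^ k = - ((-1) ^ (k - 1))"
      using k by (cases k) auto
    ultimately show ?thesis by simp
  qed
  have "(\<Sum>k=1..i-j. ?t k) = ?t 1 + (\<Sum>k=2..i-j. ?t k)"
    using assms by (simp add: sum.atLeast_Suc_atMost numeral_2_eq_2)
  also have "(\<Sum>k=2..i-j. ?t k) = (\<Sum>k=1..i-1-j. ?t (Suc k))"
    using sum.shift_bounds_cl_Suc_ivl[of ?t 1 "i - 1 - j"] assms by (simp add: numeral_2_eq_2 Suc_diff_Suc)
  also have "\<dots> = (\<Sum>k=1..i-1-j. - ((-1) ^ (k - 1) * schubert n (w_perm (i - 1) j k)))"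
    using rest by (rule sum.cong[OF refl])
  finally show ?thesis
    unfolding div_diff_alt_sum using first by (simp add: alt_sum_def sum_negf)
qed

text \<open>The term \<open>k = i - j\<close> has an ascent at \<open>j\<close> and vanishes. Every
  other term descends to the term for \<open>j + 1\<close> with the same \<open>k\<close>, so signs
  persist.\<close>

lemma div_diff_alt_sum_first:
  assumes "1 \<le> j" "j < i - 1" "i \<le> n"
  shows "div_diff j (alt_sum n i j) = alt_sum n i (j + 1)"
proof -
  let ?t = "\<lambda>k. (-1) ^ (k - 1) * div_diff j (schubert n (w_perm i j k))"
  have last: "div_diff j (schubert n (w_perm i j (i - j))) = 0"
    using assms by (intro div_diff_schubert_ascent w_perm_permutes) (auto simp: w_perm_apply)
  have rest: "?t k = (-1) ^ (k - 1) * schubert n (w_perm i (j + 1) k)" if k: "k \<in> {1..i - (j + 1)}" for k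
  proof -
    have "w_perm i j k \<circ> s_adj j = w_perm i (j + 1) k"
      using assms k by (auto simp: fun_eq_iff w_perm_apply s_adj_apply)
    moreover have "div_diff j (schubert n (w_perm i j k)) = schubert n (w_perm i j k \<circ> s_adj j)"
      using assms k by (intro div_diff_schubert_descent w_perm_permutes) (auto simp: w_perm_apply)
    ultimately show ?thesis by simp
  qed
  have ins: "{1..i - j} = insert (i - j) {1..i - (j + 1)}" "i - j \<notin> {1..i - (j + 1)}"
    using assms by auto
  have "(\<Sum>k=1..i-j. ?t k) = (\<Sum>k=1..i-(j+1). ?t k)"
    unfolding ins(1) sum.insert[OF finite_atLeastAtMost ins(2)] by (simp add: last)
  also have "\<dots> = (\<Sum>k=1..i-(j+1). (-1) ^ (k - 1) * schubert n (w_perm i (j + 1) k))"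
    using rest by (rule sum.cong[OF refl])
  finally show ?thesis
    unfolding div_diff_alt_sum by (simp only: alt_sum_def)
qed

lemma alt_sum_adjacent: "alt_sum n (Suc j) j = schubert n (s_adj j)"
proof -
  have "w_perm (Suc j) j 1 = s_adj j" by (simp add: w_perm_def s_word_Cons)
  then show ?thesis by (simp add: alt_sum_def)
qed

lemma div_diff_alt_sum_adjacent:
  assumes "1 \<le> j" "j < n"
  shows "div_diff j (alt_sum n (Suc j) j) = 1"
proof -
  have "div_diff j (schubert n (s_adj j)) = schubert n (s_adj j \<circ> s_adj j)"
    using assms by (intro div_diff_schubert_descent s_adj_permutes) (auto simp: s_adj_apply)
  then show ?thesis by (simp add: alt_sum_adjacent schubert_id)
qed

lemma keys_alt_sum:
  assumes "1 \<le> j" "j < i" "i \<le> n"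
  shows "keys (alt_sum n i j) \<subseteq> truncated_exps n"
proof -
  have sgn: "keys ((-1 :: mpoly) ^ k) \<subseteq> {0}" for k
    by (cases "even k") auto
  have "keys ((-1) ^ (k - 1) * schubert n (w_perm i j k)) \<subseteq> truncated_exps n"
    if k: "k \<in> {1..i - j}" for k
  proof (rule keys_mult_truncated)
    show "keys ((-1 :: mpoly) ^ (k - 1)) \<subseteq> insert 0 (truncated_exps n)"
      using sgn[of "k - 1"] by blast
    have w: "w_perm i j k permutes {1..n}" using assms k by (intro w_perm_permutes) auto
    show "keys (schubert n (w_perm i j k)) \<subseteq> truncated_exps n"
    \<comment> \<open>A descent is exhibited in each case: at \<open>i - 1\<close> for the last
      term, at \<open>j\<close> for the others.\<close>
    proof (cases "k = i - j")
      case True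
      have "w_perm i j k (i - 1 + 1) < w_perm i j k (i - 1)"
        using assms True by (auto simp: w_perm_apply)
      then show ?thesis using assms by (intro keys_schubert[OF w, of "i - 1"]) auto
    next
      case False
      have "w_perm i j k (j + 1) < w_perm i j k j"
        using assms False k by (auto simp: w_perm_apply)
      then show ?thesis using assms by (intro keys_schubert[OF w, of j]) auto
    qed
  qed
  then show ?thesis
    unfolding alt_sum_def using keys_sum by (rule order.trans[rotated, OF UN_least])
qed

section \<open>Divided differences of \<open>f_poly\<close>\<close>

lemma swap_vars_f_poly:
  assumes "1 \<le> r" "r \<noteq> j" "r \<noteq> i" "j \<le> i"
  shows "swap_vars r (f_poly i j) = f_poly i j"
proof -
  have "swap_vars r (f_poly i j)
    = (\<Sum>k=1..j. (\<Prod>l=j+1..i. Xvar (s_adj r k) - Xvar (s_adj r l)) * Xvar (s_adj r k))"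
    by (simp add: f_poly_def swap_vars_sum swap_vars_mult swap_vars_prod swap_vars_diff)
  \<comment> \<open>As \<open>r\<close> is neither \<open>j\<close> nor \<open>i\<close>, the swap
    maps \<open>{j+1..i}\<close> and \<open>{1..j}\<close> to themselves. The inner product is
    reindexed first, the outer sum afterwards.\<close>
  also have "\<dots> = (\<Sum>k=1..j. (\<Prod>l=j+1..i. Xvar (s_adj r k) - Xvar l) * Xvar (s_adj r k))"
  proof (intro sum.cong refl arg_cong2[of _ _ _ _ "(*)"])
    fix k
    show "(\<Prod>l=j+1..i. Xvar (s_adj r k) - Xvar (s_adj r l)) = (\<Prod>l=j+1..i. Xvar (s_adj r k) - Xvar l)"
      using assms by (intro prod.reindex_bij_witness[of _ "s_adj r" "s_adj r"]) (auto simp: s_adj_apply)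
  qed
  also have "\<dots> = f_poly i j"
    unfolding f_poly_def
    using assms by (intro sum.reindex_bij_witness[of _ "s_adj r" "s_adj r"]) (auto simp: s_adj_apply)
  finally show ?thesis .
qed

text \<open>In each summand \<open>x_i\<close> occurs only in the factor \<open>x_k - x_i\<close>,
  which is sent to -1.\<close>

lemma div_diff_f_poly_last:
  assumes "j < i"
  shows "div_diff i (f_poly i j) = - f_poly (i - 1) j"
proof -
  have "div_diff i ((\<Prod>l=j+1..i. Xvar k - Xvar l) * Xvar k) = - ((\<Prod>l=j+1..i-1. Xvar k - Xvar l) * Xvar k)"
    if k: "k \<in> {1..j}" for k
  proof -
    let ?M = "(\<Prod>l=j+1..i-1. Xvar k - Xvar l) * Xvar k"
    have "swap_vars i ?M = (\<Prod>l=j+1..i-1. Xvar (s_adj i k) - Xvar (s_adj i l)) * Xvar (s_adj i k)"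
      by (simp add: swap_vars_mult swap_vars_prod swap_vars_diff)
    also have "\<dots> = ?M"
      using k assms by (intro arg_cong2[of _ _ _ _ "(*)"] prod.cong) (auto simp: s_adj_apply)
    finally have sym: "swap_vars i ?M = ?M" .
    have ins: "{j+1..i} = insert i {j+1..i-1}" "i \<notin> {j+1..i-1}" using assms by auto
    have "(\<Prod>l=j+1..i. Xvar k - Xvar l) * Xvar k = ?M * (Xvar k - Xvar i)"
      by (simp only: ins(1) prod.insert[OF finite_atLeastAtMost ins(2)] mult_ac)
    moreover have "div_diff i (Xvar k - Xvar i) = -1"
      using k assms by (intro div_diff_eqI) (simp add: swap_vars_diff s_adj_apply)
    ultimately show ?thesis by (simp only: div_diff_symmetric_mult[OF sym]) simp
  qed
  then show ?thesis by (simp add: f_poly_def div_diff_sum sum_negf)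
qed

text \<open>Splitting off \<open>x_k - x_(j+1)\<close> leaves \<open>T k\<close>, the summand of
  \<open>f_poly i (j + 1)\<close>. For \<open>k < j\<close> the split factor is sent to 1, while
  \<open>k = j\<close> yields \<open>T j + T (j + 1)\<close> and so supplies the additional
  summand.\<close>

lemma div_diff_f_poly_first:
  assumes "1 \<le> j" "j < i"
  shows "div_diff j (f_poly i j) = f_poly i (j + 1)"
proof -
  define T where "T k = (\<Prod>l=j+2..i. Xvar k - Xvar l) * Xvar k" for k
  have swap_T: "swap_vars j (T k) = T (s_adj j k)" for k
  proof -
    have "swap_vars j (T k) = (\<Prod>l=j+2..i. Xvar (s_adj j k) - Xvar (s_adj j l)) * Xvar (s_adj j k)"
      by (simp add: T_def swap_vars_mult swap_vars_prod swap_vars_diff)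
    also have "\<dots> = T (s_adj j k)"
      unfolding T_def by (intro arg_cong2[of _ _ _ _ "(*)"] prod.cong) (auto simp: s_adj_apply)
    finally show ?thesis .
  qed
  have ins: "{j+1..i} = insert (j+1) {j+2..i}" "j + 1 \<notin> {j+2..i}" using assms by auto
  have f: "f_poly i j = (\<Sum>k=1..j. T k * (Xvar k - Xvar (j + 1)))"
    unfolding f_poly_def T_def by (intro sum.cong refl) (simp only: ins(1) prod.insert[OF finite_atLeastAtMost ins(2)] mult_ac)
  have low: "div_diff j (T k * (Xvar k - Xvar (j + 1))) = T k" if "k < j" for k
  proof -
    have "swap_vars j (T k) = T k" using swap_T[of k] that by (simp add: s_adj_apply)
    moreover have "div_diff j (Xvar k - Xvar (j + 1)) = 1"
      using that by (intro div_diff_eqI) (simp add: swap_vars_diff s_adj_apply)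
    ultimately show ?thesis using div_diff_symmetric_mult by simp
  qed
  have top: "div_diff j (T j * (Xvar j - Xvar (j + 1))) = T j + T (j + 1)"
    by (rule div_diff_eqI) (simp add: swap_vars_mult swap_vars_diff swap_T s_adj_apply algebra_simps)
  have j: "{1..j} = insert j {1..<j}" "{1..j+1} = insert (j+1) (insert j {1..<j})"
    using assms by auto
  have "div_diff j (f_poly i j) = (\<Sum>k=1..j. div_diff j (T k * (Xvar k - Xvar (j + 1))))"
    by (simp only: f div_diff_sum)
  also have "\<dots> = T j + T (j + 1) + (\<Sum>k\<in>{1..<j}. T k)"
    unfolding j using low top by simp
  also have "\<dots> = (\<Sum>k=1..j+1. T k)"
    unfolding j by (simp add: add_ac)
  finally show ?thesis by (simp add: f_poly_def T_def)
qed

lemma div_diff_f_poly_diagonal: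
  assumes "1 \<le> j"
  shows "div_diff j (f_poly j j) = 1"
proof -
  have j: "{1..j} = insert j {1..<j}" using assms by auto
  have low: "div_diff j (Xvar k) = 0" if "k \<in> {1..<j}" for k
    using that by (intro div_diff_symmetric) (simp add: s_adj_apply)
  have "div_diff j (Xvar j) = 1"
    by (rule div_diff_eqI) (simp add: s_adj_apply)
  then have "(\<Sum>k=1..j. div_diff j (Xvar k)) = 1"
    unfolding j using low by simp
  then show ?thesis by (simp add: f_poly_def div_diff_sum)
qed

section \<open>Comparison of the two recursions\<close>

lemma f_poly_eq_alt_sum:
  assumes "1 \<le> j" "j < i" "i \<le> n"
  shows "f_poly (i - 1) j = alt_sum n i j"
  using assms
\<comment> \<open>The measure decreases both for \<open>(i, j + 1)\<close> and for
  \<open>(i - 1, j)\<close>.\<close>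
proof (induction "i + (i - j)" arbitrary: i j rule: less_induct)
  case less
  note prems = less.prems
  have "f_poly (i - 1) j - alt_sum n i j = 0"
  proof (rule eq_0_if_div_diff_eq_0[of _ n])
    show "keys (f_poly (i - 1) j - alt_sum n i j) \<subseteq> truncated_exps n"
      using prems by (intro order.trans[OF keys_diff] Un_least keys_f_poly keys_alt_sum) auto
    fix r assume r: "r \<in> {1..<n}"
    have "div_diff r (f_poly (i - 1) j) = div_diff r (alt_sum n i j)"
    proof (cases "r = j \<or> r = i - 1")
      case False
      then show ?thesis
        using div_diff_alt_sum_other[OF prems r] r prems
        by (simp add: div_diff_symmetric swap_vars_f_poly)
    next
      case special: True
      show ?thesis
      \<comment> \<open>When the two special indices coincide, both images are 1 and no induction
        hypothesis is called on.\<close>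
      proof (cases "j = i - 1")
        case True
        then show ?thesis
          using special prems div_diff_f_poly_diagonal[of j] div_diff_alt_sum_adjacent[of j n] by auto
      next
        case False
        with prems have lt: "j < i - 1" by simp
        from special show ?thesis
        proof
          assume "r = j"
          then show ?thesis
            using div_diff_f_poly_first[of j "i - 1"] div_diff_alt_sum_first[of j i n] lt prems
              less.hyps[of i "j + 1"] by simp
        next
          assume "r = i - 1"
          then show ?thesis
            using div_diff_f_poly_last[of j "i - 1"] div_diff_alt_sum_last[of j i n] lt prems
              less.hyps[of "i - 1" j] by simp
        qed
      qed
    qed
    then show "div_diff r (f_poly (i - 1) j - alt_sum n i j) = 0"
      by (simp add: div_diff_diff)
  qed
  then show ?case by simp
qed

theorem theorem1p1:
  fixes n i j :: nat
  assumes "1 \<le> n" and "1 \<le> j" and "j < i" and "i \<le> n"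
  shows "f_poly (i - 1) j = (\<Sum>k=1..i-j. (-1) ^ (k - 1) * schubert n (w_perm i j k))"
  using f_poly_eq_alt_sum[OF assms(2-4)] by (simp only: alt_sum_def)

end
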